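(* Let $n\geq 2$, let $c,x\in\mathbb{R}^n$ and $p,r,\delta>0$ satisfy $|c-x|=p+r+\delta$, and let $k\geq\max(|c|,|x|)$. Let $W$ be a random vector uniformly distributed on $\mathbb{S}^{n-1}$. Put $$\mathcal{Q}=1-\Bigl(\frac{p+r}{p+r+\delta}\Bigr)^2,\qquad v=\frac{p}{p+r}\,c+\frac{r}{p+r}\,x.$$ Then $$\mathbb{P}_{W}\{\exists b\in[-k,k]:\mathsf{H}[W;b]\text{ separates }\mathsf{B}[c,r]\text{ and }\mathsf{B}[x,p]\}=I\bigl(\mathcal{Q};\tfrac{n-1}{2},\tfrac12\bigr)=\mathbb{P}_{W}\{\mathsf{H}[\mathbb{R}W,(W\mid v)W]\text{ separates }\mathsf{B}[c,r]\text{ and }\mathsf{B}[x,p]\}.$$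
   Context: $(\cdot\mid\cdot)$ and $|\cdot|$ are the Euclidean inner product and norm on $\mathbb{R}^n$, and $\mathbb{S}^{n-1}=\{u\in\mathbb{R}^n:|u|=1\}$. For $c\in\mathbb{R}^n$, $r>0$, $\mathsf{B}[c,r]=\{u\in\mathbb{R}^n:|c-u|<r\}$. For $w\in\mathbb{S}^{n-1}$ and $b\in\mathbb{R}$, $\mathsf{H}[w;b]=\{u\in\mathbb{R}^n:(w\mid u)-b=0\}$. The hyperplane $\mathsf{H}[w;b]$ separates $\mathsf{B}[c,r]$ and $\mathsf{B}[x,p]$ if either $(w\mid u)-b>0$ for all $u\in\mathsf{B}[c,r]$ and $(w\mid u)-b<0$ for all $u\in\mathsf{B}[x,p]$, or $(w\mid u)-b<0$ for all $u\in\mathsf{B}[c,r]$ and $(w\mid u)-b>0$ for all $u\in\mathsf{B}[x,p]$. Hyperplanes have a second parametrization (comma instead of semicolon): for a line $a$ through the origin of $\mathbb{R}^n$ and $v\in a$, $\mathsf{H}[a,v]=a^{\perp}+v$; thus $\mathsf{H}[w;(w\mid v)]=\mathsf{H}[\mathbb{R}w,v]$ for $w\in\mathbb{S}^{n-1}$ and $v\in\mathbb{R}w$. The regularized beta function is $I(\kappa;y,z)=\frac{1}{B(y,z)}\int_0^{\kappa}s^{y-1}(1-s)^{z-1}\,ds$ for $y,z>0$ and $\kappa\in[0,1]$, where $B(y,z)$ is the beta function. *)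

theory Defs
  imports "HOL-Probability.Probability"
begin

text \<open>
  The two parametrizations of hyperplanes. Both yield sets of points; \<^term>\<open>hyperplane w b\<close> is only
  used for unit vectors \<open>w\<close>, and \<^term>\<open>hyperplane_through a v\<close> for lines \<open>a\<close> through the origin.
\<close>

definition hyperplane :: "'a::euclidean_space \<Rightarrow> real \<Rightarrow> 'a set" where
  "hyperplane w b = {u. w \<bullet> u - b = 0}"

definition hyperplane_through :: "'a::euclidean_space set \<Rightarrow> 'a \<Rightarrow> 'a set" where
  "hyperplane_through a v = (\<lambda>u. u + v) ` orthogonal_comp a"

text \<open>
  A hyperplane determines its unit normal \<open>w\<close> and offset \<open>b\<close> up to a common sign, and the
  condition below is symmetric under that sign change, so the choice of \<open>(w, b)\<close> is immaterial.
\<close>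

definition separates :: "'a::euclidean_space set \<Rightarrow> 'a set \<Rightarrow> 'a set \<Rightarrow> bool" where
  "separates H A B \<longleftrightarrow> (\<exists>w b. norm w = 1 \<and> H = hyperplane w b \<and>
     ((\<forall>u\<in>A. w \<bullet> u - b > 0) \<and> (\<forall>u\<in>B. w \<bullet> u - b < 0) \<or>
      (\<forall>u\<in>A. w \<bullet> u - b < 0) \<and> (\<forall>u\<in>B. w \<bullet> u - b > 0)))"

definition reg_beta :: "real \<Rightarrow> real \<Rightarrow> real \<Rightarrow> real" where
  "reg_beta \<kappa> y z =
     1 / Beta y z * integral {0..\<kappa>} (\<lambda>s. s powr (y - 1) * (1 - s) powr (z - 1))"

text \<open>
  The uniform distribution on the unit sphere, i.e. the normalized surface measure
  \<open>A \<mapsto> \<lambda> {x \<in> B. x / |x| \<in> A} / \<lambda> B\<close>, where \<open>B\<close> is the unit ball and \<open>\<lambda>\<close> Lebesgue measure: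
  the image of the uniform distribution on the ball under the radial projection
  \<^term>\<open>sgn x = x /\<^sub>R norm x\<close>. Its underlying space is the sphere; \<open>sgn 0 = 0\<close> lies outside the
  sphere, but that is a null event.
\<close>

definition sphere_uniform :: "'a::euclidean_space measure" where
  "sphere_uniform =
     restrict_space (distr (uniform_measure lborel (ball 0 1)) borel sgn) (sphere 0 1)"

lemma borel_measurable_sgn_euclidean [measurable]:
  "(sgn :: 'a::euclidean_space \<Rightarrow> 'a) \<in> borel_measurable borel"
  unfolding sgn_div_norm by measurable

lemma space_sphere_uniform [simp]:
  "space (sphere_uniform :: 'a::euclidean_space measure) = sphere 0 1"
  by (simp add: sphere_uniform_def space_restrict_space)

lemma sets_sphere_uniform [measurable_cong]:
  "sets (sphere_uniform :: 'a::euclidean_space measure) = sets (restrict_space borel (sphere 0 1))"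
  unfolding sphere_uniform_def by (rule sets_restrict_space_cong) simp

lemma emeasure_lborel_unit_ball:
  "emeasure lborel (ball (0::'a::euclidean_space) 1) \<noteq> 0"
  "emeasure lborel (ball (0::'a::euclidean_space) 1) \<noteq> \<infinity>"
  using emeasure_bounded_finite[of "ball (0::'a) 1"] content_ball_pos[of 1 "0::'a"]
  by (auto simp: measure_def)

lemma emeasure_sphere_uniform:
  fixes A :: "'a::euclidean_space set"
  assumes [measurable]: "A \<in> sets borel" and A: "A \<subseteq> sphere 0 1"
  shows "emeasure sphere_uniform A =
     emeasure lborel {x \<in> ball 0 1. sgn x \<in> A} / emeasure lborel (ball (0::'a) 1)"
proof -
  have "sphere (0::'a) 1 \<in> sets borel" by simp
  then have "emeasure sphere_uniform A =
      emeasure (distr (uniform_measure lborel (ball 0 1)) borel sgn) A"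
    unfolding sphere_uniform_def using A by (intro emeasure_restrict_space) simp_all
  also have "\<dots> = emeasure (uniform_measure lborel (ball 0 1)) (sgn -` A)"
    by (subst emeasure_distr) auto
  also have "\<dots> = emeasure lborel (ball 0 1 \<inter> sgn -` A) / emeasure lborel (ball (0::'a) 1)"
    by (rule emeasure_uniform_measure) (use measurable_sets[OF borel_measurable_sgn_euclidean assms(1)] in auto)
  also have "ball 0 1 \<inter> sgn -` A = {x \<in> ball 0 1. sgn x \<in> A}" by auto
  finally show ?thesis .
qed

lemma prob_space_sphere_uniform: "prob_space (sphere_uniform :: 'a::euclidean_space measure)"
proof
  have eq: "{x \<in> ball (0::'a) 1. sgn x \<in> sphere 0 1} = ball 0 1 - {0}"
    by (auto simp: norm_sgn)
  have "emeasure lborel (ball (0::'a) 1 - {0}) = emeasure lborel (ball (0::'a) 1)"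
    by (rule emeasure_Diff_null_set) auto
  then show "emeasure sphere_uniform (space (sphere_uniform :: 'a measure)) = 1"
    using emeasure_lborel_unit_ball[where 'a='a]
    by (simp only: space_sphere_uniform eq emeasure_sphere_uniform[OF borel_closed[OF closed_sphere] order_refl])
       (simp add: ennreal_divide_self less_top)
qed

text \<open>
  Rotation invariance, which characterizes the uniform distribution on the sphere.
\<close>

lemma emeasure_lborel_orthogonal_vimage:
  fixes T :: "'a::euclidean_space \<Rightarrow> 'a"
  assumes T: "orthogonal_transformation T" and [measurable]: "A \<in> sets borel"
  shows "emeasure lborel (T -` A) = emeasure lborel A"
proof -
  obtain T' where T': "orthogonal_transformation T'" "\<And>x. T (T' x) = x"
    using T by (metis orthogonal_transformation_inv orthogonal_transformation_surj surj_f_inv_f)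
  have [measurable]: "T \<in> borel_measurable borel" "T' \<in> borel_measurable borel"
    using T T' by (auto intro!: borel_measurable_continuous_onI linear_continuous_on
        simp: orthogonal_transformation_linear linear_conv_bounded_linear[symmetric])
  define B where "B = ball (0::'a) 1"
  have [measurable]: "B \<in> sets borel"
    by (simp add: B_def)
  have TB: "T -` B = B"
    using T by (auto simp: B_def orthogonal_transformation_norm)
  have shift: "(\<integral>\<^sup>+x. f (x + t) \<partial>lborel) = (\<integral>\<^sup>+x. f x \<partial>lborel)"
    if [measurable]: "f \<in> borel_measurable borel" for f :: "'a \<Rightarrow> ennreal" and t
  proof -
    have "(\<integral>\<^sup>+x. f x \<partial>lborel) = (\<integral>\<^sup>+x. f x \<partial>distr lborel borel ((+) t))"
      by (simp add: lborel_distr_plus)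
    also have "\<dots> = (\<integral>\<^sup>+x. f (x + t) \<partial>lborel)"
      by (subst nn_integral_distr) (auto simp: add.commute)
    finally show ?thesis by simp
  qed
  have refl: "(\<integral>\<^sup>+x. f (- x) \<partial>lborel) = (\<integral>\<^sup>+x. f x \<partial>lborel)"
    if [measurable]: "f \<in> borel_measurable borel" for f :: "'a \<Rightarrow> ennreal"
  proof -
    have "(\<integral>\<^sup>+x. f x \<partial>lborel) = (\<integral>\<^sup>+x. f x \<partial>distr lborel borel (\<lambda>x::'a. 0 + (- 1) *\<^sub>R x))"
      using lborel_affine[of "- 1" "0::'a"] by (simp add: density_1)
    also have "\<dots> = (\<integral>\<^sup>+x. f (- x) \<partial>lborel)"
      by (subst nn_integral_distr) auto
    finally show ?thesis by simp
  qed
  let ?I = "\<lambda>A x. indicator A x :: ennreal"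
  have [measurable]: "T -` A \<in> sets borel"
    using measurable_sets[of T borel borel A] by simp
  have "emeasure lborel (T -` A) * emeasure lborel B =
      (\<integral>\<^sup>+x. ?I A (T x) * (\<integral>\<^sup>+y. ?I B y \<partial>lborel) \<partial>lborel)"
    by (simp add: nn_integral_multc flip: indicator_vimage)
  also have "\<dots> = (\<integral>\<^sup>+x. (\<integral>\<^sup>+y. ?I A (T x) * ?I B (y + T x) \<partial>lborel) \<partial>lborel)"
  proof (intro nn_integral_cong)
    fix x
    have "(\<integral>\<^sup>+y. ?I A (T x) * ?I B (y + T x) \<partial>lborel) = ?I A (T x) * (\<integral>\<^sup>+y. ?I B (y + T x) \<partial>lborel)"
      by (rule nn_integral_cmult, rule measurable_compose[where g = "?I B" and N = borel]) auto
    also have "(\<integral>\<^sup>+y. ?I B (y + T x) \<partial>lborel) = (\<integral>\<^sup>+y. ?I B y \<partial>lborel)"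
      by (rule shift) simp
    finally show "?I A (T x) * (\<integral>\<^sup>+y. ?I B y \<partial>lborel) = (\<integral>\<^sup>+y. ?I A (T x) * ?I B (y + T x) \<partial>lborel)" ..
  qed
  also have "\<dots> = (\<integral>\<^sup>+y. (\<integral>\<^sup>+x. ?I A (T x) * ?I B (y + T x) \<partial>lborel) \<partial>lborel)"
    by (rule lborel_pair.Fubini') measurable
  also have "\<dots> = (\<integral>\<^sup>+y. (\<integral>\<^sup>+x. ?I A (T (x + T' (- y))) * ?I B (y + T (x + T' (- y))) \<partial>lborel) \<partial>lborel)"
  proof (rule nn_integral_cong)
    fix y
    show "(\<integral>\<^sup>+x. ?I A (T x) * ?I B (y + T x) \<partial>lborel) =
        (\<integral>\<^sup>+x. ?I A (T (x + T' (- y))) * ?I B (y + T (x + T' (- y))) \<partial>lborel)"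
      using shift[of "\<lambda>x. ?I A (T x) * ?I B (y + T x)" "T' (- y)"] by simp
  qed
  also have "\<dots> = (\<integral>\<^sup>+y. (\<integral>\<^sup>+x. ?I A (T x - y) * ?I B (T x) \<partial>lborel) \<partial>lborel)"
    using T T' by (simp add: linear_add orthogonal_transformation_linear)
  also have "\<dots> = (\<integral>\<^sup>+x. (\<integral>\<^sup>+y. ?I A (T x - y) * ?I B (T x) \<partial>lborel) \<partial>lborel)"
    by (rule lborel_pair.Fubini'[symmetric]) measurable
  also have "\<dots> = (\<integral>\<^sup>+x. (\<integral>\<^sup>+y. ?I A y \<partial>lborel) * ?I B (T x) \<partial>lborel)"
  proof (intro nn_integral_cong)
    fix x
    have "(\<integral>\<^sup>+y. ?I A (T x - y) \<partial>lborel) = (\<integral>\<^sup>+y. ?I A (T x + y) \<partial>lborel)"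
      using refl[of "\<lambda>y. ?I A (T x + y)"] by simp
    also have "\<dots> = (\<integral>\<^sup>+y. ?I A y \<partial>lborel)"
      using shift[of "?I A" "T x"] by (simp add: add.commute)
    finally show "(\<integral>\<^sup>+y. ?I A (T x - y) * ?I B (T x) \<partial>lborel) = (\<integral>\<^sup>+y. ?I A y \<partial>lborel) * ?I B (T x)"
      by (subst nn_integral_multc) auto
  qed
  also have "\<dots> = emeasure lborel A * emeasure lborel (T -` B)"
    by (simp add: nn_integral_cmult TB flip: indicator_vimage)
  finally have "emeasure lborel (T -` A) * emeasure lborel B / emeasure lborel B =
      emeasure lborel A * emeasure lborel B / emeasure lborel B"
    unfolding TB by simp
  then show ?thesis
    using emeasure_lborel_unit_ball[where 'a='a]
    by (simp add: B_def ennreal_mult_divide_eq)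
qed

lemma distr_sphere_uniform_orthogonal:
  fixes T :: "'a::euclidean_space \<Rightarrow> 'a"
  assumes T: "orthogonal_transformation T"
  shows "distr sphere_uniform sphere_uniform T = sphere_uniform"
proof (rule measure_eqI)
  have [measurable]: "T \<in> borel_measurable borel"
    using T by (auto intro!: borel_measurable_continuous_onI linear_continuous_on
        simp: orthogonal_transformation_linear linear_conv_bounded_linear[symmetric])
  have sp [measurable]: "T \<in> sphere_uniform \<rightarrow>\<^sub>M sphere_uniform"
    unfolding measurable_cong_sets[OF sets_sphere_uniform sets_sphere_uniform]
    using T by (intro measurable_restrict_space2 measurable_restrict_space1)
      (auto simp: space_restrict_space orthogonal_transformation_norm)
  fix A :: "'a set" assume "A \<in> sets (distr sphere_uniform sphere_uniform T)"
  then have A: "A \<in> sets borel" "A \<subseteq> sphere 0 1" and A': "A \<in> sets sphere_uniform"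
    by (auto simp: sets_sphere_uniform sets_restrict_space_iff)
  have TA: "T -` A \<in> sets borel" "T -` A \<subseteq> sphere 0 1"
    using A T measurable_sets[of T borel borel A] by (auto simp: orthogonal_transformation_norm)
  have sgnT: "sgn (T x) = T (sgn x)" for x
    using T by (simp add: sgn_div_norm orthogonal_transformation_norm
        orthogonal_transformation_linear linear_scale)
  have meas: "{x \<in> ball 0 1. sgn x \<in> A} \<in> sets borel"
    using A(1) by measurable
  have "emeasure (distr sphere_uniform sphere_uniform T) A = emeasure sphere_uniform (T -` A)"
    using A' TA(2) by (subst emeasure_distr) (auto intro!: arg_cong[where f="emeasure _"])
  also have "\<dots> = emeasure lborel (T -` {x \<in> ball 0 1. sgn x \<in> A}) / emeasure lborel (ball (0::'a) 1)"
    unfolding emeasure_sphere_uniform[OF TA] using T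
    by (auto simp: sgnT orthogonal_transformation_norm vimage_def)
  also have "\<dots> = emeasure sphere_uniform A"
    unfolding emeasure_sphere_uniform[OF A] emeasure_lborel_orthogonal_vimage[OF T meas] ..
  finally show "emeasure (distr sphere_uniform sphere_uniform T) A = emeasure sphere_uniform A" .
qed simp

end

(* A hyperplane normal to the unit vector w separates the two balls for some offset b iff the
   projections of the balls to the line through w are disjoint, i.e. iff |(w | c - x)| >= p + r; the offset
   (w | v) then always works, and it is at most k in absolute value since v is a convex combination
   of c and x. With e = (c - x) / |c - x| and tau = (p + r) / (p + r + delta), both events therefore
   are {|(W | e)| >= tau}, whose probability is the proportion of the unit ball that lies in the
   double cone |(x | e)| >= tau |x|. After a rotation that moves e to a coordinate axis, the slices
   of the double cone at height t are (n-1)-dimensional balls of radius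
   sqrt (min (t^2 (1 / tau^2 - 1)) (1 - t^2)). *)

theory Submission
  imports Defs
begin

section \<open>Separating hyperplanes\<close>

text \<open>The component \<open>y\<close> of \<open>w'\<close> orthogonal to \<open>w\<close> is a
  direction inside the common hyperplane, so \<open>w'\<close> is orthogonal to it too. This forces
  \<open>y = 0\<close>, and two parallel unit vectors agree up to sign. The lemma is for unfolding
  \<open>separates\<close>, whose existential may supply another normal than the given one.\<close>

lemma hyperplane_eq_imp:
  fixes w w' :: "'a::euclidean_space"
  assumes w: "norm w = 1" and w': "norm w' = 1" and eq: "hyperplane w b = hyperplane w' b'"
  shows "w' = w \<or> w' = - w"
proof -
  have ww: "w \<bullet> w = 1" "w' \<bullet> w' = 1"
    using w w' by (simp_all add: dot_square_norm)
  define y where "y = w' - (w \<bullet> w') *\<^sub>R w"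
  have wy: "w \<bullet> y = 0"
    by (simp add: y_def inner_diff_right ww)
  have "b *\<^sub>R w \<in> hyperplane w b" "b *\<^sub>R w + y \<in> hyperplane w b"
    by (simp_all add: hyperplane_def inner_add_right wy ww)
  then have "b *\<^sub>R w \<in> hyperplane w' b'" "b *\<^sub>R w + y \<in> hyperplane w' b'"
    by (simp_all add: eq)
  then have "w' \<bullet> y = 0"
    by (simp add: hyperplane_def inner_add_right)
  then have "y \<bullet> y = 0"
    by (simp add: y_def inner_diff_left wy[unfolded y_def])
  then have w'_eq: "w' = (w \<bullet> w') *\<^sub>R w"
    by (simp add: y_def)
  then have "\<bar>w \<bullet> w'\<bar> = 1"
    using w w' by (metis norm_scaleR mult.right_neutral)
  then show ?thesis
    using w'_eq by (metis abs_eq_iff abs_one scaleR_minus1_left scaleR_one)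
qed

text \<open>For a unit vector \<open>w\<close>, the point \<open>(w \<bullet> v) *\<^sub>R w\<close>
  is the orthogonal projection of \<open>v\<close> to the line, so it has the same offset as
  \<open>v\<close>. This reduces the second event of the theorem to the parametrization by normal
  and offset.\<close>

lemma hyperplane_through_span:
  fixes w v :: "'a::euclidean_space"
  assumes "norm w = 1"
  shows "hyperplane_through (span {w}) ((w \<bullet> v) *\<^sub>R w) = hyperplane w (w \<bullet> v)"
proof -
  have ww: "w \<bullet> w = 1"
    using assms by (simp add: dot_square_norm)
  have comp: "u \<in> orthogonal_comp (span {w}) \<longleftrightarrow> w \<bullet> u = 0" for u
    by (auto simp: orthogonal_comp_def span_singleton orthogonal_def)
  show ?thesis
  proof (intro set_eqI iffI)
    fix u assume "u \<in> hyperplane w (w \<bullet> v)"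
    then have "u - (w \<bullet> v) *\<^sub>R w \<in> orthogonal_comp (span {w})"
      by (simp add: comp hyperplane_def inner_diff_right ww)
    then show "u \<in> hyperplane_through (span {w}) ((w \<bullet> v) *\<^sub>R w)"
      unfolding hyperplane_through_def by (rule rev_image_eqI) simp
  qed (auto simp: hyperplane_through_def comp hyperplane_def inner_add_right ww)
qed

text \<open>On the open ball the infimum of the inner product with \<open>w\<close> is
  \<open>w \<bullet> c - r\<close>, and it is not attained. Hence strict positivity on the ball
  amounts to a non-strict inequality at the centre.\<close>

lemma ball_above_hyperplane_iff:
  fixes w c :: "'a::euclidean_space"
  assumes w: "norm w = 1" and r: "r > 0"
  shows "(\<forall>u\<in>ball c r. w \<bullet> u - b > 0) \<longleftrightarrow> b + r \<le> w \<bullet> c"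
proof
  assume *: "\<forall>u\<in>ball c r. w \<bullet> u - b > 0"
  show "b + r \<le> w \<bullet> c"
  proof (rule ccontr)
    assume "\<not> b + r \<le> w \<bullet> c"
    \<comment> \<open>Moving from \<open>c\<close> by \<open>t\<close> against \<open>w\<close>
      gives a point of the ball that is not above the hyperplane. The maximum with 0 covers a centre
      that is already on the wrong side.\<close>
    define t where "t = max 0 (w \<bullet> c - b)"
    have "w \<bullet> c - b \<le> t" "0 \<le> t" "t < r"
      using \<open>\<not> b + r \<le> w \<bullet> c\<close> r by (auto simp: t_def)
    then have "c - t *\<^sub>R w \<in> ball c r"
      using w by (simp add: dist_norm)
    moreover have "w \<bullet> (c - t *\<^sub>R w) - b \<le> 0"
      using w \<open>w \<bullet> c - b \<le> t\<close> by (simp add: inner_diff_right dot_square_norm)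
    ultimately show False
      using * by fastforce
  qed
next
  assume *: "b + r \<le> w \<bullet> c"
  show "\<forall>u\<in>ball c r. w \<bullet> u - b > 0"
  proof
    fix u assume "u \<in> ball c r"
    then have "\<bar>w \<bullet> (c - u)\<bar> < r"
      using Cauchy_Schwarz_ineq2[of w "c - u"] w by (simp add: dist_norm)
    then show "w \<bullet> u - b > 0"
      using * by (simp add: inner_diff_right)
  qed
qed

lemma ball_below_hyperplane_iff:
  fixes w c :: "'a::euclidean_space"
  assumes "norm w = 1" "r > 0"
  shows "(\<forall>u\<in>ball c r. w \<bullet> u - b < 0) \<longleftrightarrow> w \<bullet> c \<le> b - r"
  using ball_above_hyperplane_iff[of "- w" r c "- b"] assms by auto

text \<open>Adding the inequalities for the two centres cancels the offset and leaves the sum of the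
  radii. The absolute value absorbs both the choice of sides and the sign of the normal.\<close>

lemma separates_imp_abs_inner_ge:
  fixes w c x :: "'a::euclidean_space"
  assumes "norm w = 1" "p > 0" "r > 0" "separates (hyperplane w b) (ball c r) (ball x p)"
  shows "p + r \<le> \<bar>w \<bullet> (c - x)\<bar>"
proof -
  obtain w' b' where w': "norm w' = 1" "hyperplane w b = hyperplane w' b'"
    and sep: "(\<forall>u\<in>ball c r. w' \<bullet> u - b' > 0) \<and> (\<forall>u\<in>ball x p. w' \<bullet> u - b' < 0) \<or>
     (\<forall>u\<in>ball c r. w' \<bullet> u - b' < 0) \<and> (\<forall>u\<in>ball x p. w' \<bullet> u - b' > 0)"
    using assms(4) unfolding separates_def by blast
  have "p + r \<le> \<bar>w' \<bullet> (c - x)\<bar>"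
    using sep unfolding ball_above_hyperplane_iff[OF w'(1) assms(2)]
      ball_below_hyperplane_iff[OF w'(1) assms(2)] ball_above_hyperplane_iff[OF w'(1) assms(3)]
      ball_below_hyperplane_iff[OF w'(1) assms(3)]
    by (auto simp: inner_diff_right)
  then show ?thesis
    using hyperplane_eq_imp[OF assms(1) w'] by auto
qed

text \<open>The point \<open>v\<close> divides the segment from \<open>c\<close> to \<open>x\<close>
  in the ratio r : p. Its offset therefore splits the gap \<open>d\<close> between the projected
  centres in proportion to the radii, and each share is large enough for its ball as soon as |d| is
  at least p + r. The sign of \<open>d\<close> decides which ball lies above.\<close>

lemma separates_hyperplane_inner:
  fixes w c x v :: "'a::euclidean_space"
  assumes w: "norm w = 1" and p: "p > 0" and r: "r > 0"
    and v: "v = (p / (p + r)) *\<^sub>R c + (r / (p + r)) *\<^sub>R x"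
    and le: "p + r \<le> \<bar>w \<bullet> (c - x)\<bar>"
  shows "separates (hyperplane w (w \<bullet> v)) (ball c r) (ball x p)"
proof -
  define d where "d = w \<bullet> (c - x)"
  have wv: "(p + r) * (w \<bullet> v) = p * (w \<bullet> c) + r * (w \<bullet> x)"
    using p r by (simp add: v inner_add_right distrib_left)
  have d1: "w \<bullet> c - w \<bullet> v = r * (d / (p + r))"
    using p r wv by (simp add: d_def inner_diff_right field_simps)
  have d2: "w \<bullet> v - w \<bullet> x = p * (d / (p + r))"
    using p r wv by (simp add: d_def inner_diff_right field_simps)
  have "d / (p + r) \<ge> 1 \<or> d / (p + r) \<le> - 1"
    using le p r by (auto simp: d_def[symmetric] field_simps abs_if split: if_splits)
  then show ?thesis
  proof
    assume "d / (p + r) \<ge> 1"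
    then have "r * 1 \<le> r * (d / (p + r))" "p * 1 \<le> p * (d / (p + r))"
      using p r mult_left_mono[of 1 "d / (p + r)" r] mult_left_mono[of 1 "d / (p + r)" p] by simp_all
    then show ?thesis
      unfolding separates_def
      using d1 d2 w ball_above_hyperplane_iff[OF w r] ball_below_hyperplane_iff[OF w p]
      by (intro exI[of _ w] exI[of _ "w \<bullet> v"]) auto
  next
    assume "d / (p + r) \<le> - 1"
    then have "r * (d / (p + r)) \<le> r * - 1" "p * (d / (p + r)) \<le> p * - 1"
      using p r mult_left_mono[of "d / (p + r)" "- 1" r] mult_left_mono[of "d / (p + r)" "- 1" p]
      by simp_all
    then show ?thesis
      unfolding separates_def
      using d1 d2 w ball_above_hyperplane_iff[OF w p] ball_below_hyperplane_iff[OF w r]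
      by (intro exI[of _ w] exI[of _ "w \<bullet> v"]) auto
  qed
qed

lemma separates_hyperplane_inner_iff:
  fixes w c x v :: "'a::euclidean_space"
  assumes "norm w = 1" "p > 0" "r > 0"
    and "v = (p / (p + r)) *\<^sub>R c + (r / (p + r)) *\<^sub>R x"
  shows "separates (hyperplane w (w \<bullet> v)) (ball c r) (ball x p) \<longleftrightarrow> p + r \<le> \<bar>w \<bullet> (c - x)\<bar>"
  using assms separates_imp_abs_inner_ge separates_hyperplane_inner by metis

lemma ex_bounded_separates_iff:
  fixes w c x :: "'a::euclidean_space"
  assumes w: "norm w = 1" and p: "p > 0" and r: "r > 0" and k: "k \<ge> max (norm c) (norm x)"
  shows "(\<exists>b\<in>{-k..k}. separates (hyperplane w b) (ball c r) (ball x p)) \<longleftrightarrow>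
    p + r \<le> \<bar>w \<bullet> (c - x)\<bar>"
proof
  assume le: "p + r \<le> \<bar>w \<bullet> (c - x)\<bar>"
  define v where "v = (p / (p + r)) *\<^sub>R c + (r / (p + r)) *\<^sub>R x"
  have "c \<in> cball 0 k" "x \<in> cball 0 k"
    using k by auto
  then have "v \<in> cball 0 k"
    unfolding v_def using p r
    by (intro convexD[OF convex_cball]) (auto simp: add_divide_distrib[symmetric])
  then have "\<bar>w \<bullet> v\<bar> \<le> k"
    using Cauchy_Schwarz_ineq2[of w v] w by simp
  then have "w \<bullet> v \<in> {-k..k}"
    by (auto simp: abs_le_iff)
  then show "\<exists>b\<in>{-k..k}. separates (hyperplane w b) (ball c r) (ball x p)"
    using separates_hyperplane_inner[OF w p r v_def le] by blast
qed (use separates_imp_abs_inner_ge[OF w p r] in blast)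

section \<open>Volume of a double cone in the unit ball\<close>

text \<open>In Gamma functions, the quotient of consecutive volumes is sqrt(pi) Gamma(m/2 + 1) /
  Gamma(m/2 + 3/2), where sqrt(pi) = Gamma(1/2).\<close>

lemma unit_ball_vol_Suc:
  "unit_ball_vol (real (Suc m)) = unit_ball_vol (real m) * Beta (1/2) (real m / 2 + 1)"
  by (auto simp: unit_ball_vol_def Beta_def Gamma_eq_zero_iff field_simps
          Gamma_one_half_real powr_half_sqrt [symmetric] powr_add [symmetric])

lemma Beta_real_pos: "a > 0 \<Longrightarrow> b > 0 \<Longrightarrow> Beta a b > (0 :: real)"
  by (simp add: Beta_def Gamma_real_pos add_pos_pos)

lemma reg_beta_nonneg:
  assumes "y > 0" "z > 0"
  shows "reg_beta \<kappa> y z \<ge> 0"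
proof -
  let ?f = "\<lambda>s. s powr (y - 1) * (1 - s) powr (z - 1)"
  \<comment> \<open>A function that is not integrable has \<open>integral\<close> 0, so the bound
    holds for every \<kappa>.\<close>
  have "integral {0..\<kappa>} ?f \<ge> 0"
    by (cases "?f integrable_on {0..\<kappa>}")
      (auto simp: not_integrable_integral intro: Henstock_Kurzweil_Integration.integral_nonneg)
  then show ?thesis
    using Beta_real_pos[OF assms] by (simp add: reg_beta_def)
qed

text \<open>This rewrites the factor m / (m + 1) of the slice integral as a quotient of two beta
  values.\<close>

lemma Beta_half_recurrence:
  assumes "m \<ge> 1"
  shows "(real m + 1) * Beta (1/2) (real m / 2 + 1) = real m * Beta (real m / 2) (1/2)"
proof -
  have "real m / 2 \<notin> \<int>\<^sub>\<le>\<^sub>0"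
    using assms by (auto elim!: nonpos_Ints_cases)
  from Beta_plus1_right[OF this, of "1/2"] show ?thesis
    by (simp add: field_simps Beta_commute)
qed

text \<open>On [0, \<tau>] the integrand is a power of t with an explicit integral; on [\<tau>, 1]
  the integral is kept as a difference of values of the antiderivative \<open>J\<close>.
  Differentiating the sum with respect to s = 1 - \<tau>^2 gives m / (2 (m + 1)) times the beta
  density, and evenness in t doubles this constant.\<close>

lemma has_integral_double_cone_slices:
  fixes \<tau> :: real
  assumes \<tau>: "0 < \<tau>" "\<tau> < 1" and m: "m \<ge> 1"
  shows "((\<lambda>t. sqrt (min (t\<^sup>2 * (1 / \<tau>\<^sup>2 - 1)) (1 - t\<^sup>2)) ^ m) has_integral
    real m / (real m + 1) *
      integral {0..1 - \<tau>\<^sup>2} (\<lambda>s. s powr (real m / 2 - 1) * (1 - s) powr (1 / 2 - 1))) {-1..1}"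
proof -
  \<comment> \<open>\<open>H (1 - \<tau>\<^sup>2)\<close> is the integral over \<open>{0..1}\<close>: the slices are cut off by the cone for \<open>t \<le> \<tau>\<close>
    and by the ball for \<open>t \<ge> \<tau>\<close>. As a function of \<open>s\<close>, \<open>H\<close> is an antiderivative of the beta density,
    up to a constant factor.\<close>
  define f where "f = (\<lambda>t::real. sqrt (1 - t\<^sup>2) ^ m)"
  define J where "J = (\<lambda>u. integral {-1..u} f)"
  define H where "H = (\<lambda>s. sqrt (1 - s) * sqrt s ^ m / (real m + 1) + (J 1 - J (sqrt (1 - s))))"
  define g where "g = (\<lambda>t. sqrt (min (t\<^sup>2 * (1 / \<tau>\<^sup>2 - 1)) (1 - t\<^sup>2)) ^ m)"
  have contf: "continuous_on A f" for A
    unfolding f_def by (intro continuous_intros)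
  \<comment> \<open>The interval extends past 1, where \<open>sqrt\<close> is still continuous, so
    that \<open>J\<close> has a two-sided derivative at 1.\<close>
  have J': "(J has_real_derivative f u) (at u)" if "-1 < u" "u < 2" for u
    using integral_has_real_derivative[of "-1" 2 f u] contf that at_within_Icc_at[of "-1" u 2]
    unfolding J_def by auto
  have f_int: "(f has_integral J 1 - J \<tau>) {\<tau>..1}"
    using \<tau> J' by (intro fundamental_theorem_of_calculus)
      (auto simp: has_real_derivative_iff_has_vector_derivative[symmetric] intro: has_field_derivative_at_within)
  have \<tau>2: "\<tau>\<^sup>2 < 1" 
    using \<tau> by (simp add: power_less_one_iff)
  then have a: "1 / \<tau>\<^sup>2 - 1 > 0"
    using \<tau> by (simp add: field_simps)
  \<comment> \<open>At height \<tau> the cone meets the unit sphere, so both formulas for the radius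
    of the slice agree.\<close>
  have sqa: "\<tau> * sqrt (1 / \<tau>\<^sup>2 - 1) = sqrt (1 - \<tau>\<^sup>2)"
  proof -
    have "sqrt (1 - \<tau>\<^sup>2) = sqrt (\<tau>\<^sup>2 * (1 / \<tau>\<^sup>2 - 1))"
      using \<tau> by (simp add: field_simps)
    then show ?thesis using \<tau> by (simp add: real_sqrt_mult)
  qed
  have min_iff: "t\<^sup>2 * (1 / \<tau>\<^sup>2 - 1) \<le> 1 - t\<^sup>2 \<longleftrightarrow> \<bar>t\<bar> \<le> \<tau>" for t
  proof -
    have "t\<^sup>2 * (1 / \<tau>\<^sup>2 - 1) \<le> 1 - t\<^sup>2 \<longleftrightarrow> t\<^sup>2 \<le> \<tau>\<^sup>2"
      using \<tau> by (simp add: field_simps)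
    then show ?thesis using \<tau> by (simp add: abs_le_square_iff[symmetric])
  qed
  have "((\<lambda>t. (t * sqrt (1 / \<tau>\<^sup>2 - 1)) ^ m) has_integral
     (\<lambda>t. t * (t * sqrt (1 / \<tau>\<^sup>2 - 1)) ^ m / (real m + 1)) \<tau> - (\<lambda>t. t * (t * sqrt (1 / \<tau>\<^sup>2 - 1)) ^ m / (real m + 1)) 0) {0..\<tau>}"
  proof (intro fundamental_theorem_of_calculus)
    fix t assume "t \<in> {0..\<tau>}"
    have "((\<lambda>t. sqrt (1 / \<tau>\<^sup>2 - 1) ^ m * t ^ Suc m / (real m + 1)) has_real_derivative
        sqrt (1 / \<tau>\<^sup>2 - 1) ^ m * t ^ m) (at t within {0..\<tau>})"
      by (rule derivative_eq_intros refl | simp add: add.commute add_pos_nonneg less_imp_neq[symmetric])+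
    then show "((\<lambda>t. t * (t * sqrt (1 / \<tau>\<^sup>2 - 1)) ^ m / (real m + 1)) has_vector_derivative
         (t * sqrt (1 / \<tau>\<^sup>2 - 1)) ^ m) (at t within {0..\<tau>})"
      by (simp add: has_real_derivative_iff_has_vector_derivative[symmetric] power_mult_distrib mult_ac)
  qed (use \<tau> in auto)
  then have "((\<lambda>t. (t * sqrt (1 / \<tau>\<^sup>2 - 1)) ^ m) has_integral \<tau> * sqrt (1 - \<tau>\<^sup>2) ^ m / (real m + 1)) {0..\<tau>}"
    by (simp add: sqa)
  then have g1: "(g has_integral \<tau> * sqrt (1 - \<tau>\<^sup>2) ^ m / (real m + 1)) {0..\<tau>}"
    by (rule has_integral_eq[rotated]) (simp add: g_def min_iff min_absorb1 real_sqrt_mult)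
  have g2: "(g has_integral J 1 - J \<tau>) {\<tau>..1}"
  proof (rule has_integral_eq[OF _ f_int])
    fix t assume t: "t \<in> {\<tau>..1}"
    have "1 - t\<^sup>2 \<le> t\<^sup>2 * (1 / \<tau>\<^sup>2 - 1)"
    proof -
      have "\<tau>\<^sup>2 \<le> t\<^sup>2" using t \<tau> by (intro power_mono) auto
      then show ?thesis using \<tau> by (simp add: field_simps)
    qed
    then show "f t = g t"
      by (simp add: f_def g_def min_absorb2)
  qed
  have H_eq: "H (1 - \<tau>\<^sup>2) = \<tau> * sqrt (1 - \<tau>\<^sup>2) ^ m / (real m + 1) + (J 1 - J \<tau>)"
    using \<tau> by (simp add: H_def)
  have g3: "(g has_integral H (1 - \<tau>\<^sup>2)) {0..1}"
    unfolding H_eq by (rule has_integral_combine[OF _ _ g1 g2]) (use \<tau> in auto)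
  \<comment> \<open>The function \<open>g\<close> depends on t only through its square.\<close>
  have "((\<lambda>t. g (- t)) has_integral H (1 - \<tau>\<^sup>2)) {- 1..- 0}"
    using g3 by (subst has_integral_reflect_real)
  then have g4: "(g has_integral H (1 - \<tau>\<^sup>2)) {- 1..0}"
    by (simp add: g_def)
  have g5: "(g has_integral (H (1 - \<tau>\<^sup>2) + H (1 - \<tau>\<^sup>2))) {- 1..1}"
    by (rule has_integral_combine[OF _ _ g4 g3]) auto

  define h where "h = (\<lambda>s. s powr (real m / 2 - 1) * (1 - s) powr (1 / 2 - 1))"
  have sqrt_bounds: "-1 < sqrt (1 - s)" "sqrt (1 - s) < 2" if "0 \<le> s" "s \<le> 1" for s
    using that by (auto intro: less_le_trans[of _ 0] real_less_lsqrt)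
  have \<tau>2_le: "s \<le> 1" if "s \<le> 1 - \<tau>\<^sup>2" for s
    using that zero_le_power2[of \<tau>] by linarith
  have H': "(H has_real_derivative real m / (2 * (real m + 1)) * h s) (at s)" if s: "0 < s" "s < 1" for s
  proof -
    have JJ: "((\<lambda>s. J (sqrt (1 - s))) has_real_derivative f (sqrt (1 - s)) * (- (1 / (2 * sqrt (1 - s))))) (at s)"
      by (rule DERIV_chain2[where f = J and g = "\<lambda>s. sqrt (1 - s)", OF J'[OF sqrt_bounds]]) (use s in \<open>auto intro!: derivative_eq_intros simp: field_simps\<close>)
    define P where "P = sqrt s"
    define R where "R = sqrt (1 - s)"
    have PR: "P > 0" "R > 0" "P\<^sup>2 = s" "R\<^sup>2 = 1 - s"
      using s by (auto simp: P_def R_def)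
    have D1: "(sqrt has_real_derivative 1 / (2 * P)) (at s)"
      using s by (auto intro!: derivative_eq_intros simp: P_def field_simps)
    have D2: "((\<lambda>s. sqrt (1 - s)) has_real_derivative - (1 / (2 * R))) (at s)"
      using s by (auto intro!: derivative_eq_intros simp: R_def field_simps)
    have D3: "((\<lambda>s. sqrt s ^ m) has_real_derivative real m * P ^ (m - 1) * (1 / (2 * P))) (at s)"
      using DERIV_power[OF D1, of m] by (simp add: P_def mult_ac)
    have D: "(H has_real_derivative
        ((- (1 / (2 * R))) * P ^ m + real m * P ^ (m - 1) * (1 / (2 * P)) * R) / (real m + 1)
        + (0 - f R * (- (1 / (2 * R))))) (at s)"
      unfolding H_def P_def R_def
      by (intro DERIV_add DERIV_cdivide DERIV_diff DERIV_const JJ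
          DERIV_mult D2[unfolded R_def] D3[unfolded P_def])
    have "f R = P ^ m"
      using PR s by (simp add: f_def P_def R_def)
    moreover have "h s = P ^ m / (P\<^sup>2 * R)"
    proof -
      have "s = P powr 2"
        using PR(1,3) by simp
      then have "s powr (real m / 2 - 1) = P powr (2 * (real m / 2 - 1))"
        by (simp only: powr_powr)
      also have "\<dots> = P powr real m / P powr 2"
        by (simp add: powr_diff)
      finally have 1: "s powr (real m / 2 - 1) = P ^ m / P\<^sup>2"
        using PR(1) by (simp add: powr_realpow)
      have "(1 - s) powr (1 / 2 - 1) = 1 / R"
        using s by (simp add: powr_minus powr_half_sqrt R_def inverse_eq_divide)
      with 1 show ?thesis by (simp add: h_def)
    qed
    moreover obtain j where j: "m = Suc j"
      using m by (cases m) auto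
    moreover have "((- (1 / (2 * R))) * P ^ m + real m * P ^ (m - 1) * (1 / (2 * P)) * R) / (real m + 1)
        + (0 - P ^ m * (- (1 / (2 * R)))) = real m / (2 * (real m + 1)) * (P ^ m / (P\<^sup>2 * R))"
    proof -
      \<comment> \<open>The factor P^2 + R^2 equals 1; inserting it makes this an identity that
        holds for all positive P and R.\<close>
      have "((- (1 / (2 * R))) * P ^ m + real m * P ^ (m - 1) * (1 / (2 * P)) * R) / (real m + 1)
        + (0 - P ^ m * (- (1 / (2 * R)))) = real m / (2 * (real m + 1)) * (P ^ m / (P\<^sup>2 * R)) * (P\<^sup>2 + R\<^sup>2)"
      proof -
        \<comment> \<open>With X for P^(m - 1) and a for m + 1, the identity becomes purely
          rational, without symbolic exponents.\<close>
        have "((- (1 / (2 * R))) * (P * X) + (a - 1) * X * (1 / (2 * P)) * R) / a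
          + (0 - P * X * (- (1 / (2 * R)))) = (a - 1) / (2 * a) * (P * X / (P\<^sup>2 * R)) * (P\<^sup>2 + R\<^sup>2)"
          if "a > 0" for a X
          using PR(1,2) that by (simp add: field_simps power2_eq_square)
        from this[of "real m + 1" "P ^ j"] show ?thesis
          by (simp add: j)
      qed
      then show ?thesis
        using PR(3,4) by simp
    qed
    ultimately show ?thesis
      using D by simp
  qed
  \<comment> \<open>The version with derivatives only in the interior is used because the density is
    unbounded near 0 when m = 1, while \<open>H\<close> is still continuous there.\<close>
  have "((\<lambda>s. real m / (2 * (real m + 1)) * h s) has_integral H (1 - \<tau>\<^sup>2) - H 0) {0..1 - \<tau>\<^sup>2}"
  proof (rule fundamental_theorem_of_calculus_interior)
    have "continuous_on {-1<..<2} J"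
      by (rule DERIV_continuous_on) (use J' in \<open>auto intro: has_field_derivative_at_within\<close>)
    then have "continuous_on {0..1 - \<tau>\<^sup>2} (\<lambda>s. J (sqrt (1 - s)))"
      by (rule continuous_on_compose2)
        (use sqrt_bounds in \<open>auto intro!: continuous_intros simp: \<tau>2_le\<close>)
    then show "continuous_on {0..1 - \<tau>\<^sup>2} H"
      unfolding H_def by (intro continuous_intros) auto
    show "(H has_vector_derivative real m / (2 * (real m + 1)) * h s) (at s)" if "s \<in> {0<..<1 - \<tau>\<^sup>2}" for s
      using H'[of s] that \<tau>2_le[of s] \<tau>(1)
      by (fastforce simp: has_real_derivative_iff_has_vector_derivative[symmetric])
  qed (use \<tau>2 in auto)
  \<comment> \<open>The value s = 0 belongs to \<tau> = 1, where the cone shrinks to its axis. Since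
    m is positive, \<open>0 ^ m\<close> vanishes.\<close>
  moreover have "H 0 = 0"
    using m by (simp add: H_def)
  ultimately have "((\<lambda>s. 2 * (real m + 1) / real m * (real m / (2 * (real m + 1)) * h s)) has_integral
      2 * (real m + 1) / real m * H (1 - \<tau>\<^sup>2)) {0..1 - \<tau>\<^sup>2}"
    using has_integral_mult_right by (metis diff_zero)
  moreover have "2 * (real m + 1) / real m * (real m / (2 * (real m + 1)) * h s) = h s" for s
  proof -
    have "2 * a / b * (b / (2 * a) * y) = y" if "a > 0" "b > 0" for a b y :: real
      using that by simp
    from this[of "real m + 1" "real m" "h s"] show ?thesis
      using m by simp
  qed
  ultimately have "integral {0..1 - \<tau>\<^sup>2} h = 2 * (real m + 1) / real m * H (1 - \<tau>\<^sup>2)"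
    by (simp add: integral_unique)
  then have "real m / (real m + 1) * integral {0..1 - \<tau>\<^sup>2} h = H (1 - \<tau>\<^sup>2) + H (1 - \<tau>\<^sup>2)"
    using m by (simp add: field_simps)
  then show ?thesis
    using g5 unfolding g_def h_def by simp
qed

text \<open>Lebesgue measure is the image of the product measure over \<open>Basis\<close>.
  Integrating over the coordinate along \<open>b\<close> last leaves, for each height t, a ball in
  the m remaining coordinates.\<close>

lemma emeasure_double_cone_slices:
  fixes b :: "'a::euclidean_space" and \<tau> :: real
  assumes b: "b \<in> Basis" and \<tau>: "0 < \<tau>" "\<tau> < 1"
  defines "m \<equiv> DIM('a) - 1"
  shows "emeasure lborel {x \<in> cball 0 1. \<tau> * norm x \<le> \<bar>x \<bullet> b\<bar>} =
    (\<integral>\<^sup>+t. ennreal (unit_ball_vol (real m)) *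
        ennreal (indicator {-1..1} t * sqrt (min (t\<^sup>2 * (1 / \<tau>\<^sup>2 - 1)) (1 - t\<^sup>2)) ^ m) \<partial>lborel)"
proof -
  interpret product_sigma_finite "\<lambda>_::'a. lborel :: real measure"
    by standard
  define A where "A = Basis - {b}"
  have A: "finite A" "b \<notin> A" and BA: "Basis = insert b A" and cardA: "card A = m"
    using b by (auto simp: A_def m_def)
  define \<rho> where "\<rho> = (\<lambda>t. sqrt (min (t\<^sup>2 * (1 / \<tau>\<^sup>2 - 1)) (1 - t\<^sup>2)))"
  define S where "S = (\<lambda>f::'a \<Rightarrow> real. \<Sum>i\<in>A. (f i)\<^sup>2)"
  define C where "C = {f::'a \<Rightarrow> real. sqrt ((f b)\<^sup>2 + S f) \<le> 1 \<and> \<tau> * sqrt ((f b)\<^sup>2 + S f) \<le> \<bar>f b\<bar>}"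
  have S_nonneg: "S f \<ge> 0" for f
    by (auto simp: S_def sum_nonneg)
  \<comment> \<open>The product space contains only extensional functions, whereas \<open>C\<close>
    ranges over all functions; hence the intersection.\<close>
  have "C \<inter> space (Pi\<^sub>M (insert b A) (\<lambda>_. lborel)) =
      {f \<in> space (Pi\<^sub>M (insert b A) (\<lambda>_. lborel)).
        sqrt ((f b)\<^sup>2 + S f) \<le> 1 \<and> \<tau> * sqrt ((f b)\<^sup>2 + S f) \<le> \<bar>f b\<bar>}"
    by (auto simp: C_def)
  also have "\<dots> \<in> sets (Pi\<^sub>M (insert b A) (\<lambda>_. lborel))"
  proof -
    have [measurable]: "(\<lambda>f. f b) \<in> borel_measurable (Pi\<^sub>M (insert b A) (\<lambda>_. lborel :: real measure))"
      "S \<in> borel_measurable (Pi\<^sub>M (insert b A) (\<lambda>_. lborel))"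
      unfolding S_def by (auto intro!: borel_measurable_sum)
    show ?thesis
      by (intro sets.sets_Collect_conj borel_measurable_le) simp_all
  qed
  finally have C_sets: "C \<inter> space (Pi\<^sub>M (insert b A) (\<lambda>_. lborel)) \<in> sets (Pi\<^sub>M (insert b A) (\<lambda>_. lborel))" .
  have "{x \<in> cball 0 1. \<tau> * norm x \<le> \<bar>x \<bullet> b\<bar>} \<in> sets (borel :: 'a measure)"
    by measurable
  then have "emeasure lborel {x \<in> cball 0 1. \<tau> * norm x \<le> \<bar>x \<bullet> b\<bar>} =
      emeasure (Pi\<^sub>M Basis (\<lambda>_. lborel)) ((\<lambda>f. \<Sum>b\<in>Basis. f b *\<^sub>R b) -` {x \<in> cball 0 1. \<tau> * norm x \<le> \<bar>x \<bullet> b\<bar>}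
        \<inter> space (Pi\<^sub>M Basis (\<lambda>_. lborel)))"
    by (subst lborel_eq, subst emeasure_distr) auto
  also have "(\<lambda>f. \<Sum>b\<in>Basis. f b *\<^sub>R b) -` {x \<in> cball 0 1. \<tau> * norm x \<le> \<bar>x \<bullet> b\<bar>} = C"
  proof -
    have "norm (\<Sum>b\<in>Basis. f b *\<^sub>R b :: 'a) = sqrt ((f b)\<^sup>2 + S f)" for f
    proof -
      have "norm (\<Sum>b\<in>Basis. f b *\<^sub>R b :: 'a) = sqrt (\<Sum>i\<in>Basis. (f i)\<^sup>2)"
        unfolding norm_conv_dist by (subst euclidean_dist_l2) (auto simp: L2_set_def)
      then show ?thesis
        using A by (simp add: BA S_def)
    qed
    moreover have "(\<Sum>b\<in>Basis. f b *\<^sub>R b :: 'a) \<bullet> b = f b" for f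
      using b by simp
    ultimately show ?thesis
      by (auto simp: C_def)
  qed
  also have "emeasure (Pi\<^sub>M Basis (\<lambda>_. lborel)) (C \<inter> space (Pi\<^sub>M Basis (\<lambda>_. lborel))) =
      (\<integral>\<^sup>+ f. indicator (C \<inter> space (Pi\<^sub>M (insert b A) (\<lambda>_. lborel))) f \<partial>Pi\<^sub>M (insert b A) (\<lambda>_. lborel))"
    unfolding BA using C_sets by (rule nn_integral_indicator[symmetric])
  also have "\<dots> = (\<integral>\<^sup>+ t. \<integral>\<^sup>+ f. indicator (C \<inter> space (Pi\<^sub>M (insert b A) (\<lambda>_. lborel))) (f(b := t))
      \<partial>Pi\<^sub>M A (\<lambda>_. lborel) \<partial>lborel)"
    using A C_sets by (subst product_nn_integral_insert_rev) auto
  also have "\<dots> = (\<integral>\<^sup>+ t. \<integral>\<^sup>+ f. indicator {-1..1} t *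
      indicator ({f. sqrt (\<Sum>i\<in>A. (f i)\<^sup>2) \<le> \<rho> t} \<inter> space (Pi\<^sub>M A (\<lambda>_. lborel))) f
      \<partial>Pi\<^sub>M A (\<lambda>_. lborel) \<partial>lborel)"
  proof (intro nn_integral_cong)
    fix t :: real and f :: "'a \<Rightarrow> real"
    assume f: "f \<in> space (Pi\<^sub>M A (\<lambda>_. lborel))"
    have Sf: "S (f(b := t)) = S f"
      using A unfolding S_def by (intro sum.cong) auto
    \<comment> \<open>The ball and the cone each bound \<open>S f\<close> from above. The smaller
      bound is the one under the root in \<open>\<rho> t\<close>, and since \<open>sqrt\<close> is
      strictly increasing on all reals, the bounds can be compared under it whatever their
      sign.\<close>
    have 1: "sqrt (t\<^sup>2 + S f) \<le> 1 \<longleftrightarrow> S f \<le> 1 - t\<^sup>2"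
      using real_sqrt_le_1_iff by auto
    have "\<tau> * sqrt (t\<^sup>2 + S f) \<le> \<bar>t\<bar> \<longleftrightarrow> (\<tau> * sqrt (t\<^sup>2 + S f))\<^sup>2 \<le> t\<^sup>2"
      using \<tau> S_nonneg[of f] by (subst abs_le_square_iff[symmetric]) (simp add: abs_mult)
    also have "\<dots> \<longleftrightarrow> S f \<le> t\<^sup>2 * (1 / \<tau>\<^sup>2 - 1)"
      using \<tau> S_nonneg[of f] by (simp add: power_mult_distrib field_simps)
    finally have 2: "\<tau> * sqrt (t\<^sup>2 + S f) \<le> \<bar>t\<bar> \<longleftrightarrow> S f \<le> t\<^sup>2 * (1 / \<tau>\<^sup>2 - 1)" .
    have 3: "t \<in> {-1..1}" if "S f \<le> 1 - t\<^sup>2"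
    proof -
      have "t\<^sup>2 \<le> 1" using that S_nonneg[of f] by linarith
      then show ?thesis by (auto simp: abs_square_le_1 abs_le_iff)
    qed
    have "f(b := t) \<in> C \<longleftrightarrow> t \<in> {-1..1} \<and> sqrt (S f) \<le> \<rho> t"
      using 1 2 3 by (auto simp: C_def Sf \<rho>_def)
    moreover have "f(b := t) \<in> space (Pi\<^sub>M (insert b A) (\<lambda>_. lborel))"
      using f by (auto simp: space_PiM PiE_def extensional_def)
    ultimately show "indicator (C \<inter> space (Pi\<^sub>M (insert b A) (\<lambda>_. lborel))) (f(b := t)) =
      (indicator {-1..1} t *
        indicator ({f. sqrt (\<Sum>i\<in>A. (f i)\<^sup>2) \<le> \<rho> t} \<inter> space (Pi\<^sub>M A (\<lambda>_. lborel))) f :: ennreal)"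
      using f by (auto simp: indicator_def S_def)
  qed
  also have "\<dots> = (\<integral>\<^sup>+ t. indicator {-1..1} t * emeasure (Pi\<^sub>M A (\<lambda>_. lborel))
      ({f. sqrt (\<Sum>i\<in>A. (f i)\<^sup>2) \<le> \<rho> t} \<inter> space (Pi\<^sub>M A (\<lambda>_. lborel))) \<partial>lborel)"
    using A by (intro nn_integral_cong, subst nn_integral_cmult_indicator) auto
  also have "\<dots> = (\<integral>\<^sup>+ t. ennreal (unit_ball_vol (real m)) *
        ennreal (indicator {-1..1} t * \<rho> t ^ m) \<partial>lborel)"
  proof (intro nn_integral_cong_AE)
    \<comment> \<open>At these three heights the slice radius is 0, while the volume formula for
      balls is applied with a positive radius.\<close>
    have "AE t in lborel. t \<notin> {- 1, 0, 1 :: real}"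
      by (intro AE_not_in countable_imp_null_set_lborel) auto
    then show "AE t in lborel. indicator {-1..1} t * emeasure (Pi\<^sub>M A (\<lambda>_. lborel))
      ({f. sqrt (\<Sum>i\<in>A. (f i)\<^sup>2) \<le> \<rho> t} \<inter> space (Pi\<^sub>M A (\<lambda>_. lborel))) =
      ennreal (unit_ball_vol (real m)) * ennreal (indicator {-1..1} t * \<rho> t ^ m)"
    proof eventually_elim
      case (elim t)
      show ?case
      proof (cases "t \<in> {-1..1}")
        case True
        then have "\<bar>t\<bar> < 1"
          using elim by auto
        then have "t\<^sup>2 < 1"
          by (simp add: abs_square_less_1)
        moreover have "1 / \<tau>\<^sup>2 - 1 > 0"
          using \<tau> by (simp add: field_simps power_less_one_iff)
        ultimately have "\<rho> t > 0"
          using elim by (simp add: \<rho>_def)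
        then show ?thesis
          using True emeasure_cball_aux[OF A(1)] cardA by (simp add: ennreal_mult)
      qed simp
    qed
  qed
  finally show ?thesis
    unfolding \<rho>_def .
qed

text \<open>The factor m / (m + 1) is Beta(1/2, m/2 + 1) / Beta(m/2, 1/2). Its numerator raises the
  unit ball volume from dimension m to m + 1, and its denominator normalizes the incomplete beta
  integral.\<close>

lemma emeasure_double_cone:
  fixes b :: "'a::euclidean_space" and \<tau> :: real
  assumes b: "b \<in> Basis" and \<tau>: "0 < \<tau>" "\<tau> < 1" and dim: "DIM('a) \<ge> 2"
  shows "emeasure lborel {x \<in> cball 0 1. \<tau> * norm x \<le> \<bar>x \<bullet> b\<bar>} =
    ennreal (unit_ball_vol DIM('a) * reg_beta (1 - \<tau>\<^sup>2) ((real DIM('a) - 1) / 2) (1 / 2))"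
proof -
  define m where "m = DIM('a) - 1"
  have m: "m \<ge> 1" and dim_eq: "DIM('a) = Suc m"
    using dim by (auto simp: m_def)
  define I where
    "I = integral {0..1 - \<tau>\<^sup>2} (\<lambda>s. s powr (real m / 2 - 1) * (1 - s) powr (1 / 2 - 1))"
  have "\<tau>\<^sup>2 < 1"
    using \<tau> by (simp add: power_less_one_iff)
  then have nonneg: "0 \<le> min (t\<^sup>2 * (1 / \<tau>\<^sup>2 - 1)) (1 - t\<^sup>2)" if "t \<in> {-1..1}" for t
    using that \<tau> by (auto simp: abs_square_le_1 abs_le_iff field_simps intro!: mult_left_le_one_le)
  have "emeasure lborel {x \<in> cball 0 1. \<tau> * norm x \<le> \<bar>x \<bullet> b\<bar>} =
    ennreal (unit_ball_vol (real m)) *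
    (\<integral>\<^sup>+t. ennreal (indicator {-1..1} t * sqrt (min (t\<^sup>2 * (1 / \<tau>\<^sup>2 - 1)) (1 - t\<^sup>2)) ^ m) \<partial>lborel)"
    unfolding emeasure_double_cone_slices[OF b \<tau>] m_def by (rule nn_integral_cmult) measurable
  also have "(\<integral>\<^sup>+t. ennreal (indicator {-1..1} t * sqrt (min (t\<^sup>2 * (1 / \<tau>\<^sup>2 - 1)) (1 - t\<^sup>2)) ^ m) \<partial>lborel)
      = ennreal (real m / (real m + 1) * I)"
    by (rule nn_integral_has_integral_lebesgue[OF _ has_integral_double_cone_slices[OF \<tau> m, folded I_def]])
      (use nonneg in simp)
  also have "ennreal (unit_ball_vol (real m)) * ennreal (real m / (real m + 1) * I) =
      ennreal (unit_ball_vol (real m) * (real m / (real m + 1)) * I)"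
    by (simp add: ennreal_mult'[symmetric] mult_ac)
  also have "unit_ball_vol (real m) * (real m / (real m + 1)) * I =
      unit_ball_vol (Suc m) * reg_beta (1 - \<tau>\<^sup>2) (real m / 2) (1 / 2)"
  proof -
    have "Beta (real m / 2) (1 / 2) > 0"
      using m by (intro Beta_real_pos) auto
    then have "real m / (real m + 1) = Beta (1/2) (real m / 2 + 1) / Beta (real m / 2) (1/2)"
      using Beta_half_recurrence[OF m] by (simp add: field_simps)
    then show ?thesis
      by (simp add: reg_beta_def I_def unit_ball_vol_Suc del: of_nat_Suc)
  qed
  finally show ?thesis
    by (simp add: dim_eq)
qed

section \<open>From the double cone in the ball to the double cap on the sphere\<close>

lemma measure_sphere_uniform_double_cap:
  fixes e :: "real ^ 'n" and \<tau> :: real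
  assumes e: "norm e = 1" and \<tau>: "0 < \<tau>" "\<tau> < 1" and dim: "CARD('n) \<ge> 2"
  shows "measure sphere_uniform {u \<in> sphere 0 1. \<tau> \<le> \<bar>u \<bullet> e\<bar>} =
    reg_beta (1 - \<tau>\<^sup>2) ((real CARD('n) - 1) / 2) (1 / 2)"
proof -
  define A where "A = {u \<in> sphere (0::real^'n) 1. \<tau> \<le> \<bar>u \<bullet> e\<bar>}"
  have A: "A \<in> sets borel" "A \<subseteq> sphere 0 1"
    unfolding A_def by (measurable, auto)
  obtain b :: "real ^ 'n" where b: "b \<in> Basis"
    using nonempty_Basis by blast
  \<comment> \<open>The rotation takes the axis \<open>e\<close> to a basis vector, for which the
    volume of the cone is known.\<close>
  obtain T where T: "orthogonal_transformation T" "T e = b"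
    using orthogonal_transformation_exists_1[of e b] e b by auto
  define K where "K = {x \<in> cball (0::real^'n) 1. \<tau> * norm x \<le> \<bar>x \<bullet> b\<bar>}"
  have K: "K \<in> sets borel"
    unfolding K_def by measurable
  \<comment> \<open>The two sets compared below differ only here: the cone \<open>K\<close> contains
    the origin and boundary points of the closed ball, while the radial preimage of \<open>A\<close>
    lies in the open ball and omits the origin.\<close>
  define N where "N = sphere (0::real^'n) 1 \<union> {0}"
  have "sphere (0::real^'n) 1 \<in> null_sets lborel"
    using negligible_sphere[of "0::real^'n" 1]
    by (auto simp: null_sets_completion_iff negligible_iff_null_sets negligible_convex_frontier)
  then have N: "N \<in> null_sets lborel"
    unfolding N_def by (rule null_sets.Un) (simp add: countable_imp_null_set_lborel)
  have "T x \<bullet> b = x \<bullet> e" for x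
    using T by (metis orthogonal_transformation_def)
  then have TK: "T -` K = {x \<in> cball 0 1. \<tau> * norm x \<le> \<bar>x \<bullet> e\<bar>}"
    using T by (auto simp: K_def orthogonal_transformation_norm)
  have sets: "{x \<in> ball 0 1. sgn x \<in> A} \<in> sets lborel" "T -` K \<in> sets lborel"
    unfolding TK using A(1) by measurable
  \<comment> \<open>The cone inequality is homogeneous: away from the origin, dividing it by the
    norm of x gives the cap inequality for \<open>sgn x\<close>.\<close>
  have "{x \<in> ball 0 1. sgn x \<in> A} - N = T -` K - N"
    unfolding TK by (auto simp: A_def N_def norm_sgn sgn_div_norm field_simps abs_mult)
  then have "emeasure lborel {x \<in> ball 0 1. sgn x \<in> A} = emeasure lborel (T -` K)"
    using emeasure_Diff_null_set[OF N] sets by metis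
  also have "\<dots> = emeasure lborel K"
    by (rule emeasure_lborel_orthogonal_vimage[OF T(1) K])
  also have "\<dots> = ennreal (unit_ball_vol CARD('n) * reg_beta (1 - \<tau>\<^sup>2) ((real CARD('n) - 1) / 2) (1 / 2))"
    unfolding K_def using emeasure_double_cone[OF b \<tau>] dim by simp
  finally have "emeasure sphere_uniform A = 
      ennreal (unit_ball_vol CARD('n) * reg_beta (1 - \<tau>\<^sup>2) ((real CARD('n) - 1) / 2) (1 / 2))
        / ennreal (unit_ball_vol CARD('n))"
    unfolding emeasure_sphere_uniform[OF A] by (simp add: emeasure_ball)
  \<comment> \<open>Nonnegativity matters because \<open>ennreal\<close> sends negative reals to
    0.\<close>
  moreover have "reg_beta (1 - \<tau>\<^sup>2) ((real CARD('n) - 1) / 2) (1 / 2) \<ge> 0"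
    using dim by (intro reg_beta_nonneg) auto
  ultimately have "emeasure sphere_uniform A = 
      ennreal (reg_beta (1 - \<tau>\<^sup>2) ((real CARD('n) - 1) / 2) (1 / 2))"
    using unit_ball_vol_pos[of "real CARD('n)"] by (simp add: divide_ennreal less_imp_neq[symmetric])
  then show ?thesis
    using \<open>_ \<ge> 0\<close> unfolding A_def measure_def by simp
qed

section \<open>Both separation events as the double cap event\<close>

theorem mainTheorem2:
  fixes c x v :: "real ^ 'n" and p r \<delta> k Q :: real
    and M :: "'w measure" and W :: "'w \<Rightarrow> real ^ 'n"
  assumes "CARD('n) \<ge> 2"
    and "p > 0" "r > 0" "\<delta> > 0"
    and "norm (c - x) = p + r + \<delta>"
    and "k \<ge> max (norm c) (norm x)"
    and "prob_space M"
    and "W \<in> M \<rightarrow>\<^sub>M sphere_uniform"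
    and "distr M sphere_uniform W = sphere_uniform"
    and "Q = 1 - ((p + r) / (p + r + \<delta>))\<^sup>2"
    and "v = (p / (p + r)) *\<^sub>R c + (r / (p + r)) *\<^sub>R x"
  shows "measure M {\<omega> \<in> space M. \<exists>b\<in>{-k..k}. separates (hyperplane (W \<omega>) b) (ball c r) (ball x p)}
           = reg_beta Q ((real CARD('n) - 1) / 2) (1 / 2)
       \<and> reg_beta Q ((real CARD('n) - 1) / 2) (1 / 2)
           = measure M {\<omega> \<in> space M.
               separates (hyperplane_through (span {W \<omega>}) ((W \<omega> \<bullet> v) *\<^sub>R W \<omega>)) (ball c r) (ball x p)}"
proof -
  define \<tau> where "\<tau> = (p + r) / (p + r + \<delta>)"
  define e where "e = (c - x) /\<^sub>R norm (c - x)"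
  define A where "A = {u \<in> sphere (0::real^'n) 1. \<tau> \<le> \<bar>u \<bullet> e\<bar>}"
  have \<tau>: "0 < \<tau>" "\<tau> < 1"
    using assms(2-4) by (auto simp: \<tau>_def)
  have norm_pos: "norm (c - x) > 0"
    using assms(2-5) by simp
  then have e: "norm e = 1"
    by (simp add: e_def)
  have normW: "norm (W \<omega>) = 1" if "\<omega> \<in> space M" for \<omega>
    using measurable_space[OF assms(8) that] by simp
  \<comment> \<open>Normalizing c - x divides the threshold p + r by the distance p + r + \<delta>
    of the centres, which gives \<tau>.\<close>
  have A_iff: "W \<omega> \<in> A \<longleftrightarrow> p + r \<le> \<bar>W \<omega> \<bullet> (c - x)\<bar>" if "\<omega> \<in> space M" for \<omega>
  proof -
    have "\<bar>W \<omega> \<bullet> e\<bar> = \<bar>W \<omega> \<bullet> (c - x)\<bar> / (p + r + \<delta>)"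
      using assms(2-5) by (simp add: e_def abs_mult divide_inverse_commute)
    moreover have "p + r + \<delta> > 0"
      using assms(2-4) by simp
    ultimately show ?thesis
      using normW[OF that] by (simp add: A_def \<tau>_def divide_le_cancel)
  qed
  have "A \<in> sets borel"
    unfolding A_def by measurable
  then have "A \<in> sets sphere_uniform"
    by (auto simp: sets_sphere_uniform sets_restrict_space_iff A_def)
  then have "measure M (W -` A \<inter> space M) = measure sphere_uniform A"
    using measure_distr[OF assms(8), of A] assms(9) by simp
  also have "\<dots> = reg_beta Q ((real CARD('n) - 1) / 2) (1 / 2)"
    unfolding A_def assms(10) \<tau>_def[symmetric]
    by (rule measure_sphere_uniform_double_cap[OF e \<tau> assms(1)])
  finally have prob: "measure M (W -` A \<inter> space M) = reg_beta Q ((real CARD('n) - 1) / 2) (1 / 2)" .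
  \<comment> \<open>Both events equal the preimage of the double cap exactly, not just up to a null
    set.\<close>
  have "{\<omega> \<in> space M. \<exists>b\<in>{-k..k}. separates (hyperplane (W \<omega>) b) (ball c r) (ball x p)} =
      W -` A \<inter> space M"
    using ex_bounded_separates_iff[OF normW assms(2,3,6)] A_iff by blast
  moreover have "{\<omega> \<in> space M. separates (hyperplane_through (span {W \<omega>}) ((W \<omega> \<bullet> v) *\<^sub>R W \<omega>))
      (ball c r) (ball x p)} = W -` A \<inter> space M"
    using separates_hyperplane_inner_iff[OF normW assms(2,3,11)] A_iff
    by (auto simp: hyperplane_through_span normW)
  ultimately show ?thesis
    using prob by simp
qed

end
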